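(* Let $n>p+1>2$, let $h=\lceil (n+p+1)/2\rceil$, and let $\pmb X$ be a data set of $n$ observations in general position in $\mathbb{R}^p$. Then the finite sample breakdown point of the PCS location estimator $\pmb t^*$ at $\pmb X$ is $$\varepsilon_n^*(\pmb t^*,\pmb X)=\frac{n-h+1}{n}.$$
   Context: **Data and contamination.** $\pmb X$ is an $n\times p$ real data matrix of genuine observations $\pmb x_1,\dots,\pmb x_n\in\mathbb{R}^p$. It is in general position in $\mathbb{R}^p$ if no more than $p$ points of $\pmb X$ lie in any $(p-1)$-dimensional affine subspace (so any $p+1$ points determine a $p$-simplex with non-zero determinant). Standing assumptions on $\pmb X$: $\sup_{\pmb a\in\mathbb{R}^p,\,\pmb a\neq 0}\max_i (\pmb x_i'\pmb a/\|\pmb a\|)^2$ is bounded, and $\|\pmb x_i-\pmb x_j\|>0$ for all $1\leqslant i<j\leqslant n$. For an integer $c$ with $1\leqslant c\leqslant n$, let $\varepsilon=c/n$ and $g=n-c$. A corrupted data set $\pmb X^{\varepsilon}$ is an $n\times p$ matrix with rows $\pmb x_i^\varepsilon$ consisting of $g$ observations from $\pmb X$ and $c$ arbitrary vectors of $\mathbb{R}^p$ (the genuine rows are arranged to be the first $g$ rows and the contaminated ones the last $c$ rows). $\mathcal{X}^{\varepsilon}$ is the set of all such corrupted data sets. **PCS estimators.** Let $\pmb X$ here denote any (possibly contaminated) data set with rows $\pmb x_1,\dots,\pmb x_n\in\mathbb{R}^p$. An $h$-subset is a subset of $\{1,\dots,n\}$ of size $h$; there are $M=\binom nh$ of them, $H^1,\dots,H^M$.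 For an $h$-subset $H^m$, $B(H^m)$ is the set of all vectors $\pmb a$ normal to hyperplanes spanned by a $p$-subset of $H^m$, i.e. such that the hyperplane $\{\pmb x\in\mathbb{R}^p:\pmb x'\pmb a=1\}$ contains $p$ observations with index in $H^m$. Put $d_i^2(\pmb a)=(\pmb a'\pmb x_i-1)^2/\|\pmb a\|^2$, let $d_{(h)}^2(\pmb a)$ be the $h$-th order statistic (in increasing order) of $d_1^2(\pmb a),\dots,d_n^2(\pmb a)$, and let $H^{\pmb a}=\{i: d_i^2(\pmb a)\leqslant d_{(h)}^2(\pmb a)\}$. The incongruence index of $H^m$ along $\pmb a$ is $$I(H^m,\pmb a)=\log\left(\frac{\mathrm{ave}_{i\in H^m} d_i^2(\pmb a)}{\mathrm{ave}_{i\in H^{\pmb a}} d_i^2(\pmb a)}\right),\qquad \log(0/0):=0,$$ where $\mathrm{ave}$ denotes the arithmetic mean, and $I(H^m)=\mathrm{ave}_{\pmb a\in B(H^m)} I(H^m,\pmb a)$. The optimal subset is $H^*=\arg\min_{\{H^m\}_{m=1}^M} I(H^m)$. Special case: if there is $\pmb a^*\in B(H^* )$ with $|\{i:d_i^2(\pmb a^* )=0\}|\geqslant h$, then $H^*$ is replaced by $\{i:d_i^2(\pmb a^* )=0\}$. The PCS estimator of location is the sample mean over $H^*$: $\pmb t^*(\pmb X)=\mathrm{ave}_{i\in H^*}\pmb x_i$. **Breakdown point of location.** For an affine equivariant location estimator $\pmb t$, $$\mathrm{bias}(\pmb t,\pmb X,\varepsilon)=\sup_{\pmb X^\varepsilon\in\mathcal{X}^\varepsilon}\|\pmb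 t(\pmb X^\varepsilon)-\pmb t(\pmb X)\|,$$ and the finite sample breakdown point is $$\varepsilon_n^*(\pmb t,\pmb X)=\min_{1\leqslant c\leqslant n}\left\{\varepsilon=\frac cn:\ \mathrm{bias}(\pmb t,\pmb X,\varepsilon)=\infty\right\}.$$
   Formalization: The normalisation x'a=1 drops hyperplanes through the origin, which makes the claim false (e.g. if 0 is an observation); here a data set spanning such a hyperplane is first shifted to an origin on no spanned hyperplane, then shifted back. Ties in the argmin are broken arbitrarily. *)

theory Defs
  imports "HOL-Analysis.Analysis"
begin

text \<open>
  A data set of \<open>n\<close> observations in \<open>p\<close>-space is a list of length \<open>n\<close> over \<open>real ^ 'p\<close>, where
  \<open>p = CARD('p)\<close>; the list entries are the rows of the data matrix.  Index sets are subsets of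
  \<open>{..<n}\<close>.  Observations are counted by index, so that repeated rows of a contaminated data set
  count separately.
\<close>

definition general_position :: "(real ^ 'p) list \<Rightarrow> bool" where
  "general_position X \<longleftrightarrow>
     (\<forall>A. affine A \<and> aff_dim A = int CARD('p) - 1 \<longrightarrow>
          card {i. i < length X \<and> X ! i \<in> A} \<le> CARD('p))"


subsection \<open>The PCS criterion\<close>

definition h_subsets :: "(real ^ 'p) list \<Rightarrow> nat \<Rightarrow> nat set set" where
  "h_subsets X h = {H. H \<subseteq> {..<length X} \<and> card H = h}"

definition spanned_hyperplanes :: "(real ^ 'p) list \<Rightarrow> nat set \<Rightarrow> (real ^ 'p) set set" where
  "spanned_hyperplanes X H =
     {F. \<exists>S\<subseteq>H. card S = CARD('p) \<and> F = affine hull ((!) X ` S) \<and> aff_dim F = int CARD('p) - 1}"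

text \<open>The set \<open>B(H)\<close>.\<close>

definition normals :: "(real ^ 'p) list \<Rightarrow> nat set \<Rightarrow> (real ^ 'p) set" where
  "normals X H = {a. {x. x \<bullet> a = 1} \<in> spanned_hyperplanes X H}"

definition sqdist :: "(real ^ 'p) list \<Rightarrow> real ^ 'p \<Rightarrow> nat \<Rightarrow> real" where
  "sqdist X a i = (a \<bullet> (X ! i) - 1)\<^sup>2 / (norm a)\<^sup>2"

definition sqdist_order_stat :: "(real ^ 'p) list \<Rightarrow> nat \<Rightarrow> real ^ 'p \<Rightarrow> real" where
  "sqdist_order_stat X h a = sort (map (sqdist X a) [0..<length X]) ! (h - 1)"

definition closest :: "(real ^ 'p) list \<Rightarrow> nat \<Rightarrow> real ^ 'p \<Rightarrow> nat set" where
  "closest X h a = {i. i < length X \<and> sqdist X a i \<le> sqdist_order_stat X h a}"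

definition ave :: "('b \<Rightarrow> real) \<Rightarrow> 'b set \<Rightarrow> real" where
  "ave f A = (\<Sum>i\<in>A. f i) / real (card A)"

definition log_ratio :: "real \<Rightarrow> real \<Rightarrow> ereal" where
  "log_ratio x y =
     (if x = 0 \<and> y = 0 then 0 else if y = 0 then \<infinity> else if x = 0 then -\<infinity> else ereal (ln (x / y)))"

definition incongruence_along :: "(real ^ 'p) list \<Rightarrow> nat \<Rightarrow> nat set \<Rightarrow> real ^ 'p \<Rightarrow> ereal" where
  "incongruence_along X h H a =
     log_ratio (ave (sqdist X a) H) (ave (sqdist X a) (closest X h a))"

text \<open>
  For \<open>card H = h\<close> the value \<open>-\<infinity>\<close> of \<^const>\<open>log_ratio\<close> never enters the following sum: if the
  squared distances vanish on \<open>H\<close>, they also vanish on \<open>closest X h a\<close>.  If \<open>normals X H\<close> is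
  empty, the average is \<open>0\<close> by convention.
\<close>

definition incongruence :: "(real ^ 'p) list \<Rightarrow> nat \<Rightarrow> nat set \<Rightarrow> ereal" where
  "incongruence X h H =
     (\<Sum>a\<in>normals X H. incongruence_along X h H a) / ereal (real (card (normals X H)))"

definition optimal_subset :: "(real ^ 'p) list \<Rightarrow> nat \<Rightarrow> nat set \<Rightarrow> bool" where
  "optimal_subset X h H \<longleftrightarrow> is_arg_min (incongruence X h) (\<lambda>H. H \<in> h_subsets X h) H"

definition exact_fit :: "(real ^ 'p) list \<Rightarrow> real ^ 'p \<Rightarrow> nat set" where
  "exact_fit X a = {i. i < length X \<and> sqdist X a i = 0}"

definition pcs_subset :: "(real ^ 'p) list \<Rightarrow> nat \<Rightarrow> nat set \<Rightarrow> bool" where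
  "pcs_subset X h H \<longleftrightarrow>
     (\<exists>H0. optimal_subset X h H0 \<and>
        (if \<exists>a\<in>normals X H0. card (exact_fit X a) \<ge> h
         then \<exists>a\<in>normals X H0. card (exact_fit X a) \<ge> h \<and> H = exact_fit X a
         else H = H0))"

text \<open>
  The minimiser (and the exactly fitting normal) need not be unique, so the PCS location is a
  relation between data sets and points.
\<close>

definition pcs_location :: "(real ^ 'p) list \<Rightarrow> nat \<Rightarrow> real ^ 'p \<Rightarrow> bool" where
  "pcs_location X h v \<longleftrightarrow>
     (\<exists>H. pcs_subset X h H \<and> v = (1 / real (card H)) *\<^sub>R (\<Sum>i\<in>H. X ! i))"


subsection \<open>The PCS estimator of location\<close>

text \<open>
  A hyperplane can be written as \<open>{x. x \<bullet> a = 1}\<close> only if it misses the origin.  If a data set spans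
  a hyperplane through the origin, the normalisation is carried out relative to another origin \<open>z\<close>
  that lies on none of the spanned hyperplanes, as (affine, in particular shift) equivariance of the
  estimator requires.  Such a \<open>z\<close> always exists and its choice is immaterial
  (\<open>ex_origin\<close> and \<open>pcs_location_shift\<close> below); in particular \<open>z = 0\<close> can be taken whenever
  \<open>normalizable X\<close> holds.
\<close>

definition normalizable :: "(real ^ 'p) list \<Rightarrow> bool" where
  "normalizable X \<longleftrightarrow> (\<forall>F\<in>spanned_hyperplanes X {..<length X}. 0 \<notin> F)"

definition shift :: "real ^ 'p \<Rightarrow> (real ^ 'p) list \<Rightarrow> (real ^ 'p) list" where
  "shift z X = map (\<lambda>x. x - z) X"

text \<open>
  \<open>t\<close> selects, for each data set of \<open>n\<close> observations, a PCS location; ties may be broken arbitrarily.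
\<close>

definition pcs_location_estimator ::
  "nat \<Rightarrow> nat \<Rightarrow> ((real ^ 'p) list \<Rightarrow> real ^ 'p) \<Rightarrow> bool" where
  "pcs_location_estimator n h t \<longleftrightarrow>
     (\<forall>X. length X = n \<longrightarrow>
        (\<exists>z. normalizable (shift z X) \<and> pcs_location (shift z X) h (t X - z)))"


subsection \<open>Breakdown point\<close>

text \<open>
  The contamination rate is \<open>\<epsilon> = c / n\<close>; it is represented by \<open>c\<close>.
\<close>

definition corrupted :: "(real ^ 'p) list \<Rightarrow> nat \<Rightarrow> (real ^ 'p) list set" where
  "corrupted X c =
     {Y. length Y = length X \<and> mset (take (length X - c) Y) \<subseteq># mset X}"

definition bias ::
  "((real ^ 'p) list \<Rightarrow> real ^ 'p) \<Rightarrow> (real ^ 'p) list \<Rightarrow> nat \<Rightarrow> ereal" where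
  "bias t X c = (SUP Y\<in>corrupted X c. ereal (norm (t Y - t X)))"

definition breakdown_point ::
  "((real ^ 'p) list \<Rightarrow> real ^ 'p) \<Rightarrow> (real ^ 'p) list \<Rightarrow> real" where
  "breakdown_point t X =
     Min {real c / real (length X) | c. 1 \<le> c \<and> c \<le> length X \<and> bias t X c = \<infinity>}"


subsection \<open>Well-definedness of the estimator\<close>

lemma length_shift [simp]: "length (shift z X) = length X"
  by (simp add: shift_def)

lemma nth_shift [simp]: "i < length X \<Longrightarrow> shift z X ! i = X ! i - z"
  by (simp add: shift_def)

lemma shift_shift [simp]: "shift z (shift w X) = shift (w + z) X"
  by (simp add: shift_def algebra_simps)

lemma shift_0 [simp]: "shift 0 X = X"
  by (simp add: shift_def)

lemma spanned_shift_sub: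
  assumes H: "H \<subseteq> {..<length X}" and F: "F \<in> spanned_hyperplanes X H"
  shows "(+) (- z) ` F \<in> spanned_hyperplanes (shift z X) H"
proof -
  obtain S where S: "S \<subseteq> H" "card S = CARD('a)" "F = affine hull ((!) X ` S)"
    "aff_dim F = int CARD('a) - 1"
    using F unfolding spanned_hyperplanes_def by blast
  have "(!) (shift z X) ` S = (+) (- z) ` ((!) X ` S)"
    using S(1) H by (force simp: image_iff)
  then have "affine hull ((!) (shift z X) ` S) = (+) (- z) ` F"
    using S(3) affine_hull_translation[of "- z" "(!) X ` S"] by simp
  moreover have "aff_dim ((+) (- z) ` F) = aff_dim F"
    by (rule aff_dim_translation_eq)
  ultimately show ?thesis
    unfolding spanned_hyperplanes_def using S by auto
qed

lemma spanned_shift: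
  assumes "H \<subseteq> {..<length X}"
  shows "spanned_hyperplanes (shift z X) H = (\<lambda>F. (+) (- z) ` F) ` spanned_hyperplanes X H"
proof
  show "(\<lambda>F. (+) (- z) ` F) ` spanned_hyperplanes X H \<subseteq> spanned_hyperplanes (shift z X) H"
    using spanned_shift_sub[OF assms] by blast
  show "spanned_hyperplanes (shift z X) H \<subseteq> (\<lambda>F. (+) (- z) ` F) ` spanned_hyperplanes X H"
  proof
    fix F assume "F \<in> spanned_hyperplanes (shift z X) H"
    then have "(+) z ` F \<in> spanned_hyperplanes X H"
      using spanned_shift_sub[of H "shift z X" F "- z"] assms by simp
    moreover have "F = (+) (- z) ` ((+) z ` F)"
      by (simp add: image_image)
    ultimately show "F \<in> (\<lambda>F. (+) (- z) ` F) ` spanned_hyperplanes X H"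
      by blast
  qed
qed

lemma spanned_mono: "H \<subseteq> K \<Longrightarrow> spanned_hyperplanes X H \<subseteq> spanned_hyperplanes X K"
  unfolding spanned_hyperplanes_def by blast

lemma finite_spanned: "finite H \<Longrightarrow> finite (spanned_hyperplanes X H)"
  by (rule finite_subset[of _ "(\<lambda>S. affine hull ((!) X ` S)) ` Pow H"])
    (auto simp: spanned_hyperplanes_def)

lemma normalizable_shift:
  "normalizable (shift z X) \<longleftrightarrow> (\<forall>F\<in>spanned_hyperplanes X {..<length X}. z \<notin> F)"
  unfolding normalizable_def by (auto simp: spanned_shift image_iff)

lemma ex_origin: "\<exists>z. normalizable (shift z X)"
proof -
  have "negligible F" if F: "F \<in> spanned_hyperplanes X {..<length X}" for F
  proof -
    have "aff_dim F = int DIM(real ^ 'a) - 1"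
      using F by (auto simp: spanned_hyperplanes_def)
    then obtain a b where "a \<noteq> 0" "affine hull F = {x. a \<bullet> x = b}"
      using aff_dim_eq_hyperplane[of F] by auto
    then have "negligible (affine hull F)"
      by (simp add: negligible_hyperplane)
    then show ?thesis
      by (rule negligible_subset) (rule hull_subset)
  qed
  then have "negligible (\<Union> (spanned_hyperplanes X {..<length X}))"
    by (intro negligible_Union finite_spanned) auto
  then have "\<Union> (spanned_hyperplanes X {..<length X}) \<noteq> UNIV"
    using non_negligible_UNIV by metis
  then show ?thesis
    by (auto simp: normalizable_shift)
qed

lemma mem_translation: "x \<in> (+) (- z) ` S \<longleftrightarrow> x + z \<in> S" for z :: "real ^ 'p"
proof
  assume "x \<in> (+) (- z) ` S"
  then obtain y where "y \<in> S" "x = - z + y"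
    by (rule imageE)
  then show "x + z \<in> S"
    by simp
next
  assume "x + z \<in> S"
  then show "x \<in> (+) (- z) ` S"
    by (rule rev_image_eqI) simp
qed

definition rescale :: "real ^ 'p \<Rightarrow> real ^ 'p \<Rightarrow> real ^ 'p" where
  "rescale z a = (1 / (1 - z \<bullet> a)) *\<^sub>R a"

lemma rescale:
  assumes H: "H \<subseteq> {..<length X}" and N: "normalizable (shift z X)" and a: "a \<in> normals X H"
  shows "z \<bullet> a \<noteq> 1"
    and "rescale z a \<in> normals (shift z X) H"
    and "i < length X \<Longrightarrow> sqdist (shift z X) (rescale z a) i = sqdist X a i"
    and "rescale (- z) (rescale z a) = a"
proof -
  have F: "{x. x \<bullet> a = 1} \<in> spanned_hyperplanes X H"
    using a by (simp add: normals_def)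
  then have "{x. x \<bullet> a = 1} \<in> spanned_hyperplanes X {..<length X}"
    by (rule subsetD[OF spanned_mono[OF H]])
  then have "z \<notin> {x. x \<bullet> a = 1}"
    by (rule bspec[OF iffD1[OF normalizable_shift N]])
  then show s: "z \<bullet> a \<noteq> 1"
    by simp
  have "x \<in> (+) (- z) ` {x. x \<bullet> a = 1} \<longleftrightarrow> x \<bullet> rescale z a = 1" for x
  proof -
    have "x \<in> (+) (- z) ` {x. x \<bullet> a = 1} \<longleftrightarrow> (x + z) \<bullet> a = 1"
      by (simp only: mem_translation mem_Collect_eq)
    also have "\<dots> \<longleftrightarrow> x \<bullet> rescale z a = 1"
      using s by (auto simp: rescale_def inner_add_left field_simps)
    finally show ?thesis .
  qed
  then have "{x. x \<bullet> rescale z a = 1} = (+) (- z) ` {x. x \<bullet> a = 1}"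
    by auto
  then show "rescale z a \<in> normals (shift z X) H"
    using spanned_shift_sub[OF H F, of z] by (simp add: normals_def)
  show "rescale (- z) (rescale z a) = a"
    using s by (simp add: rescale_def field_simps)
  show "sqdist (shift z X) (rescale z a) i = sqdist X a i" if "i < length X"
  proof -
    define s where "s = 1 - z \<bullet> a"
    have s0: "s \<noteq> 0" using s by (simp add: s_def)
    have "rescale z a \<bullet> (X ! i - z) - 1 = (a \<bullet> (X ! i) - 1) / s"
      using s0 by (simp add: rescale_def s_def[symmetric] inner_diff_right divide_simps)
        (simp add: s_def inner_commute)
    moreover have "(norm (rescale z a))\<^sup>2 = (norm a)\<^sup>2 / s\<^sup>2"
      by (simp add: rescale_def s_def[symmetric] power_divide power_mult_distrib)
    ultimately show ?thesis
      using s0 that by (simp add: sqdist_def power_divide)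
  qed
qed

lemma closest_rescale:
  assumes "H \<subseteq> {..<length X}" "normalizable (shift z X)" "a \<in> normals X H"
  shows "closest (shift z X) h (rescale z a) = closest X h a"
    and "exact_fit (shift z X) (rescale z a) = exact_fit X a"
proof -
  have "map (sqdist (shift z X) (rescale z a)) [0..<length X] = map (sqdist X a) [0..<length X]"
    using rescale(3)[OF assms] by simp
  then have "sqdist_order_stat (shift z X) h (rescale z a) = sqdist_order_stat X h a"
    by (simp only: sqdist_order_stat_def length_shift)
  then show "closest (shift z X) h (rescale z a) = closest X h a"
    unfolding closest_def using rescale(3)[OF assms] by auto
  show "exact_fit (shift z X) (rescale z a) = exact_fit X a"
    unfolding exact_fit_def using rescale(3)[OF assms] by auto
qed

lemma incongruence_along_rescale:
  assumes H: "H \<subseteq> {..<length X}" "normalizable (shift z X)" "a \<in> normals X H"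
  shows "incongruence_along (shift z X) h H (rescale z a) = incongruence_along X h H a"
proof -
  have "ave (sqdist (shift z X) (rescale z a)) A = ave (sqdist X a) A" if "A \<subseteq> {..<length X}" for A
  proof -
    have "(\<Sum>i\<in>A. sqdist (shift z X) (rescale z a) i) = (\<Sum>i\<in>A. sqdist X a i)"
      by (rule sum.cong) (use that rescale(3)[OF H] in auto)
    then show ?thesis by (simp add: ave_def)
  qed
  moreover have "closest X h a \<subseteq> {..<length X}"
    by (auto simp: closest_def)
  ultimately show ?thesis
    using H(1) by (simp add: incongruence_along_def closest_rescale[OF H])
qed

lemma normals_shift:
  assumes "H \<subseteq> {..<length X}" "normalizable X" "normalizable (shift z X)"
  shows "bij_betw (rescale z) (normals X H) (normals (shift z X) H)"
proof (rule bij_betw_byWitness[where f' = "rescale (- z)"])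
  show "\<forall>a\<in>normals X H. rescale (- z) (rescale z a) = a"
    using rescale(4)[OF assms(1,3)] by blast
  have *: "H \<subseteq> {..<length (shift z X)}" "normalizable (shift (- z) (shift z X))"
    using assms by simp_all
  show "\<forall>a\<in>normals (shift z X) H. rescale z (rescale (- z) a) = a"
    using rescale(4)[OF *] by simp
  show "rescale z ` normals X H \<subseteq> normals (shift z X) H"
    using rescale(2)[OF assms(1,3)] by blast
  show "rescale (- z) ` normals (shift z X) H \<subseteq> normals X H"
    using rescale(2)[OF *] by auto
qed

lemma pcs_subset_shift:
  assumes N: "normalizable X" "normalizable (shift z X)"
  shows "pcs_subset (shift z X) h H \<longleftrightarrow> pcs_subset X h H"
proof -
  have inc: "incongruence (shift z X) h K = incongruence X h K" if "K \<in> h_subsets X h" for K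
  proof -
    have K: "K \<subseteq> {..<length X}" using that by (simp add: h_subsets_def)
    note b = normals_shift[OF K N]
    have "(\<Sum>a\<in>normals (shift z X) K. incongruence_along (shift z X) h K a)
        = (\<Sum>a\<in>normals X K. incongruence_along (shift z X) h K (rescale z a))"
      by (rule sum.reindex_bij_betw[OF b, symmetric])
    also have "\<dots> = (\<Sum>a\<in>normals X K. incongruence_along X h K a)"
      by (rule sum.cong) (use incongruence_along_rescale[OF K N(2)] in auto)
    finally show ?thesis
      using bij_betw_same_card[OF b] by (simp add: incongruence_def)
  qed
  have hs: "h_subsets (shift z X) h = h_subsets X h"
    by (simp add: h_subsets_def)
  have opt: "optimal_subset (shift z X) h K \<longleftrightarrow> optimal_subset X h K" for K
    unfolding optimal_subset_def is_arg_min_def hs using inc by metis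
  have ex: "(\<exists>a\<in>normals (shift z X) K. P (exact_fit (shift z X) a))
      \<longleftrightarrow> (\<exists>a\<in>normals X K. P (exact_fit X a))"
    if "optimal_subset X h K" for K P
  proof -
    have K: "K \<subseteq> {..<length X}"
      using that by (simp add: optimal_subset_def is_arg_min_def h_subsets_def)
    have "normals (shift z X) K = rescale z ` normals X K"
      using normals_shift[OF K N] by (simp add: bij_betw_def)
    then show ?thesis
      using closest_rescale(2)[OF K N(2)] by auto
  qed
  have "(optimal_subset X h K \<and>
        (if \<exists>a\<in>normals (shift z X) K. card (exact_fit (shift z X) a) \<ge> h
         then \<exists>a\<in>normals (shift z X) K. card (exact_fit (shift z X) a) \<ge> h
                \<and> H = exact_fit (shift z X) a
         else H = K))
      \<longleftrightarrow> (optimal_subset X h K \<and>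
        (if \<exists>a\<in>normals X K. card (exact_fit X a) \<ge> h
         then \<exists>a\<in>normals X K. card (exact_fit X a) \<ge> h \<and> H = exact_fit X a
         else H = K))" for K
    using ex[where K = K and P = "\<lambda>E. card E \<ge> h"]
      ex[where K = K and P = "\<lambda>E. card E \<ge> h \<and> H = E"]
    by (cases "optimal_subset X h K") simp_all
  then show ?thesis
    unfolding pcs_subset_def opt by blast
qed

lemma pcs_subset_card:
  assumes "pcs_subset X h H"
  shows "H \<subseteq> {..<length X}" "h \<le> card H"
proof -
  obtain H0 where H0: "optimal_subset X h H0" "H = H0 \<or> (\<exists>a. card (exact_fit X a) \<ge> h \<and> H = exact_fit X a)"
    using assms unfolding pcs_subset_def by metis
  have "H0 \<subseteq> {..<length X}" "card H0 = h"
    using H0(1) by (simp_all add: optimal_subset_def is_arg_min_def h_subsets_def)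
  moreover have "exact_fit X a \<subseteq> {..<length X}" for a
    by (auto simp: exact_fit_def)
  ultimately show "H \<subseteq> {..<length X}" "h \<le> card H"
    using H0(2) by auto
qed

theorem pcs_location_shift:
  assumes "0 < h" "normalizable X" "normalizable (shift z X)"
  shows "pcs_location (shift z X) h (v - z) \<longleftrightarrow> pcs_location X h v"
proof -
  have "v - z = (1 / real (card H)) *\<^sub>R (\<Sum>i\<in>H. shift z X ! i)
      \<longleftrightarrow> v = (1 / real (card H)) *\<^sub>R (\<Sum>i\<in>H. X ! i)"
    if "pcs_subset X h H" for H
  proof -
    note H = pcs_subset_card[OF that]
    have c: "card H > 0" using H(2) assms(1) by simp
    have "(\<Sum>i\<in>H. shift z X ! i) = (\<Sum>i\<in>H. X ! i - z)"
      by (rule sum.cong) (use H(1) in auto)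
    then have "(1 / real (card H)) *\<^sub>R (\<Sum>i\<in>H. shift z X ! i)
        = (1 / real (card H)) *\<^sub>R (\<Sum>i\<in>H. X ! i) - z"
      using c by (simp add: sum_subtractf scaleR_diff_right sum_constant_scaleR del: sum_constant)
    then show ?thesis by simp
  qed
  then show ?thesis
    unfolding pcs_location_def pcs_subset_shift[OF assms(2,3)] by blast
qed

theorem ex_pcs_location_estimator:
  assumes "h \<le> n"
  shows "\<exists>t :: (real ^ 'p) list \<Rightarrow> real ^ 'p. pcs_location_estimator n h t"
proof -
  have "\<exists>v z. normalizable (shift z X) \<and> pcs_location (shift z X) h (v - z)"
    if "length X = n" for X :: "(real ^ 'p) list"
  proof -
    obtain z where z: "normalizable (shift z X)"
      using ex_origin by blast
    let ?Z = "shift z X"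
    have "finite (h_subsets ?Z h)"
      by (rule finite_subset[of _ "Pow {..<length X}"]) (auto simp: h_subsets_def)
    moreover have "{..<h} \<in> h_subsets ?Z h"
      using that assms by (auto simp: h_subsets_def)
    ultimately obtain H0 where H0: "optimal_subset ?Z h H0"
      unfolding optimal_subset_def is_arg_min_linorder
      using ex_min_if_finite[of "incongruence ?Z h ` h_subsets ?Z h"] by (force simp: not_less)
    then obtain H where "pcs_subset ?Z h H"
      unfolding pcs_subset_def by metis
    then have "\<exists>w. pcs_location ?Z h w"
      unfolding pcs_location_def by blast
    then obtain w where "pcs_location ?Z h ((w + z) - z)"
      by auto
    then show ?thesis
      using z by blast
  qed
  then show ?thesis
    unfolding pcs_location_estimator_def by metis
qed

end

theory Submission
  imports Defs
begin

text \<open>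
  If at most \<open>n - h\<close> observations are contaminated, an \<open>h\<close>-subset of genuine observations has an
  incongruence index that is bounded independently of the contamination.  The optimal subset
  contains \<open>p + 1\<close> genuine observations, the vertices of a simplex.  A remote observation in the
  optimal subset is remote from the hyperplane through some facet of this simplex, while \<open>h\<close>
  observations are close to that hyperplane; this makes the index of the optimal subset large, a
  contradiction.  Indices along other directions cannot compensate, as all are at least \<open>- ln n\<close>.
  All distances are measured to hyperplanes, so the constants do not depend on the origin used for
  the normalisation.
\<close>

section \<open>Distances to hyperplanes and to the vertices of a simplex\<close>

lemma infdist_hyperplane:
  fixes a :: "'a::real_inner"
  assumes "a \<noteq> 0"
  shows "infdist x {y. a \<bullet> y = b} = \<bar>a \<bullet> x - b\<bar> / norm a"
proof (rule antisym)
  let ?F = "{y. a \<bullet> y = b}"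
  define y where "y = x - ((a \<bullet> x - b) / (a \<bullet> a)) *\<^sub>R a"
  have y: "y \<in> ?F"
    using assms by (simp add: y_def inner_diff_right)
  have "dist x y = \<bar>a \<bullet> x - b\<bar> / (norm a)\<^sup>2 * norm a"
    by (simp add: y_def dist_norm dot_square_norm)
  also have "\<dots> = \<bar>a \<bullet> x - b\<bar> / norm a"
    using assms by (simp add: power2_eq_square)
  finally show "infdist x ?F \<le> \<bar>a \<bullet> x - b\<bar> / norm a"
    using infdist_le[OF y, of x] by simp
  have "\<bar>a \<bullet> x - b\<bar> / norm a \<le> dist x w" if "w \<in> ?F" for w
  proof -
    have "\<bar>a \<bullet> x - b\<bar> = \<bar>a \<bullet> (x - w)\<bar>"
      using that by (simp add: inner_diff_right)
    also have "\<dots> \<le> norm a * norm (x - w)"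
      by (rule Cauchy_Schwarz_ineq2)
    finally show ?thesis
      using assms by (simp add: dist_norm field_simps)
  qed
  then show "\<bar>a \<bullet> x - b\<bar> / norm a \<le> infdist x ?F"
    using y unfolding infdist_def by (auto intro!: cINF_greatest)
qed

lemma infdist_translation:
  fixes x z :: "'a::real_normed_vector"
  shows "infdist (z + x) ((+) z ` A) = infdist x A"
  by (simp add: infdist_def image_image)

lemma norm_mean_le:
  fixes f :: "'b \<Rightarrow> 'a::real_normed_vector"
  assumes "\<And>i. i \<in> A \<Longrightarrow> norm (f i) \<le> B" "0 \<le> B"
  shows "norm ((1 / real (card A)) *\<^sub>R sum f A) \<le> B"
proof -
  have "norm (sum f A) \<le> real (card A) * B"
    using assms(1) by (rule sum_norm_bound)
  then show ?thesis
    using assms(2) by (cases "card A = 0") (auto simp: field_simps)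
qed

text \<open>The weight of the vertex \<open>s\<close> in \<open>y\<close> is the ratio of the distances of \<open>y\<close> and \<open>s\<close> from the
  facet opposite to \<open>s\<close>.\<close>

lemma dist_simplex_vertex_le:
  fixes T :: "'a::euclidean_space set"
  assumes T: "finite T" and y: "y \<in> affine hull T" and v: "v \<in> T" and \<delta>: "\<delta> > 0"
    and facet: "\<And>s. s \<in> T \<Longrightarrow> \<exists>a b. a \<noteq> 0 \<and> T - {s} \<subseteq> {x. a \<bullet> x = b} \<and>
                  \<delta> * norm a \<le> \<bar>a \<bullet> s - b\<bar> \<and> \<bar>a \<bullet> y - b\<bar> \<le> r * norm a"
    and D: "\<And>s. s \<in> T \<Longrightarrow> dist s v \<le> D"
  shows "dist y v \<le> real (card T) * (r / \<delta> * D)"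
proof -
  obtain u where u: "sum u T = 1" "(\<Sum>s\<in>T. u s *\<^sub>R s) = y"
    using y T by (auto simp: affine_hull_finite)
  have "\<bar>u s\<bar> \<le> r / \<delta>" if s: "s \<in> T" for s
  proof -
    obtain a b where ab: "a \<noteq> 0" "T - {s} \<subseteq> {x. a \<bullet> x = b}"
      "\<delta> * norm a \<le> \<bar>a \<bullet> s - b\<bar>" "\<bar>a \<bullet> y - b\<bar> \<le> r * norm a"
      using facet[OF s] by blast
    have "a \<bullet> y - b = (\<Sum>x\<in>T. u x * (a \<bullet> x)) - (\<Sum>x\<in>T. u x * b)"
      using u by (auto simp: inner_sum_right simp flip: sum_distrib_right)
    also have "\<dots> = (\<Sum>x\<in>T. u x * (a \<bullet> x - b))"
      by (simp add: sum_subtractf right_diff_distrib)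
    also have "\<dots> = u s * (a \<bullet> s - b) + (\<Sum>x\<in>T - {s}. u x * (a \<bullet> x - b))"
      using T s by (rule sum.remove)
    also have "(\<Sum>x\<in>T - {s}. u x * (a \<bullet> x - b)) = 0"
      by (rule sum.neutral) (use ab(2) in auto)
    finally have "\<bar>u s\<bar> * \<bar>a \<bullet> s - b\<bar> \<le> r * norm a"
      using ab(4) by (simp add: abs_mult)
    moreover have "\<bar>u s\<bar> * (\<delta> * norm a) \<le> \<bar>u s\<bar> * \<bar>a \<bullet> s - b\<bar>"
      using ab(3) by (rule mult_left_mono) simp
    ultimately have "(\<bar>u s\<bar> * \<delta>) * norm a \<le> r * norm a"
      by simp
    then show ?thesis
      using ab(1) \<delta> by (simp add: field_simps)
  qed
  then have "\<bar>u s\<bar> * norm (s - v) \<le> r / \<delta> * D" if "s \<in> T" for s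
    using D[OF that] that by (intro mult_mono) (force simp: dist_norm intro: order_trans[OF abs_ge_zero])+
  then have "norm (u s *\<^sub>R (s - v)) \<le> r / \<delta> * D" if "s \<in> T" for s
    using that by simp
  then have "norm (\<Sum>s\<in>T. u s *\<^sub>R (s - v)) \<le> real (card T) * (r / \<delta> * D)"
    by (rule sum_norm_bound)
  moreover have "(\<Sum>s\<in>T. u s *\<^sub>R (s - v)) = y - v"
    using u by (simp add: scaleR_diff_right sum_subtractf flip: scaleR_sum_left)
  ultimately show ?thesis
    by (simp add: dist_norm)
qed

section \<open>Order statistics and averages in the extended reals\<close>

lemma card_sort_nth:
  fixes f :: "nat \<Rightarrow> 'a::linorder"
  assumes "0 < h" "h \<le> n"
  defines "v \<equiv> sort (map f [0..<n]) ! (h - 1)"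
  shows "h \<le> card {i. i < n \<and> f i \<le> v}" and "card {i. i < n \<and> f i < v} < h"
proof -
  let ?s = "sort (map f [0..<n])"
  \<comment> \<open>Sorting only permutes the values, so both counts can be made on the sorted list,
    where position determines order.\<close>
  have eq: "card {i. i < n \<and> P (f i)} = card {j. j < n \<and> P (?s ! j)}" for P
  proof -
    have "length (filter P (map f [0..<n])) = length (filter P ?s)"
      by (metis mset_filter mset_sort size_mset)
    then show ?thesis
      by (simp add: length_filter_conv_card cong: conj_cong)
  qed
  have "{..<h} \<subseteq> {j. j < n \<and> ?s ! j \<le> v}"
    using assms by (auto simp: v_def intro!: sorted_nth_mono)
  from card_mono[OF _ this] show "h \<le> card {i. i < n \<and> f i \<le> v}"
    by (simp add: eq[of "\<lambda>x. x \<le> v"])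
  have "j < h - 1" if "j < n" "?s ! j < v" for j
  proof (rule ccontr)
    assume "\<not> j < h - 1"
    then have "v \<le> ?s ! j"
      unfolding v_def using that(1) by (intro sorted_nth_mono) auto
    then show False using that(2) by simp
  qed
  then have "{j. j < n \<and> ?s ! j < v} \<subseteq> {..<h - 1}"
    by auto
  from card_mono[OF _ this] show "card {i. i < n \<and> f i < v} < h"
    using assms(1) by (simp add: eq[of "\<lambda>x. x < v"])
qed

lemma ereal_average_le:
  fixes f :: "'b \<Rightarrow> ereal"
  assumes "\<And>a. a \<in> A \<Longrightarrow> f a \<le> ereal U" "0 \<le> U"
  shows "sum f A / ereal (real (card A)) \<le> ereal U"
proof (cases "card A = 0")
  case True
  \<comment> \<open>The average over an empty or infinite set is 0 by convention;
    \<open>0 \<le> U\<close> covers this case.\<close>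
  then have "sum f A = 0"
    by (auto simp: card_eq_0_iff)
  then show ?thesis
    using assms(2) by simp
next
  case False
  have "sum f A \<le> (\<Sum>a\<in>A. ereal U)"
    using assms(1) by (rule sum_mono)
  then show ?thesis
    using False by (subst ereal_divide_le_pos) auto
qed

text \<open>A term is the total minus the others, so lower bounds on the others turn a bound on the
  average into one on each term. Replacing the cardinality by \<open>m\<close> makes it
  uniform.\<close>

lemma le_ereal_average:
  fixes f :: "'b \<Rightarrow> ereal"
  assumes avg: "sum f A / ereal (real (card A)) \<le> ereal U" "0 \<le> U"
    and low: "\<And>a. a \<in> A \<Longrightarrow> ereal (- l) \<le> f a" "0 \<le> l"
    and A: "finite A" "card A \<le> m" "a \<in> A"
  shows "f a \<le> ereal (real m * (U + l))"
proof -
  have c: "card A > 0"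
    using A card_gt_0_iff by blast
  have "(\<Sum>a\<in>A - {a}. ereal (- l)) \<le> sum f (A - {a})"
    using low(1) by (intro sum_mono) auto
  then have rest: "ereal (- (real (card A) - 1) * l) \<le> sum f (A - {a})"
    using A c by (simp add: of_nat_diff Suc_leI algebra_simps)
  have "f a + sum f (A - {a}) \<le> ereal (real (card A) * U)"
    using avg(1) c sum.remove[OF A(1,3), of f] by (subst (asm) ereal_divide_le_pos) auto
  \<comment> \<open>The finite lower bound excludes \<open>-\<infinity>\<close> for the rest, and
    then \<open>f a = \<infinity>\<close> is excluded as well.\<close>
  with rest have "f a \<le> ereal (real (card A) * U + (real (card A) - 1) * l)"
    by (cases "f a"; cases "sum f (A - {a})") (auto simp: algebra_simps)
  also have "\<dots> \<le> ereal (real m * (U + l))"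
  proof -
    have "(real (card A) - 1) * l \<le> real m * l" "real (card A) * U \<le> real m * U"
      using A(2) avg(2) low(2) by (auto intro!: mult_right_mono)
    then show ?thesis
      by (simp add: distrib_left)
  qed
  finally show ?thesis .
qed


section \<open>The incongruence index\<close>

text \<open>\<open>x \<bullet> 0 = 1\<close> has no solution, whereas a spanned hyperplane has
  dimension at least 0.\<close>

lemma normals_nonzero:
  assumes "a \<in> normals X H"
  shows "a \<noteq> 0"
proof
  assume "a = 0"
  then have "{} \<in> spanned_hyperplanes X H"
    using assms by (simp add: normals_def)
  then show False
    by (auto simp: spanned_hyperplanes_def aff_dim_empty)
qed

text \<open>A normal is determined by its hyperplane, and that by a subset of \<open>H\<close> whose
  rows span it. The bound depends on \<open>card H\<close> alone, not on the data.\<close>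

lemma card_normals_le:
  fixes X :: "(real ^ 'p) list"
  assumes "finite H"
  shows "finite (normals X H)" "card (normals X H) \<le> 2 ^ card H"
proof -
  let ?F = "\<lambda>a::real ^ 'p. {x. x \<bullet> a = 1}"
  have inj: "inj_on ?F (normals X H)"
  proof (rule inj_onI)
    fix a b assume ab: "a \<in> normals X H" "b \<in> normals X H" "?F a = ?F b"
    have 0: "a \<noteq> 0" "b \<noteq> 0"
      using ab normals_nonzero by blast+
    \<comment> \<open>These are the points of the two hyperplanes nearest to the origin; each lies
      on both, so \<open>a \<bullet> b\<close> equals both \<open>a \<bullet> a\<close> and
      \<open>b \<bullet> b\<close>.\<close>
    have "(1 / (a \<bullet> a)) *\<^sub>R a \<in> ?F a" "(1 / (b \<bullet> b)) *\<^sub>R b \<in> ?F b"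
      using 0 by auto
    then have "(1 / (a \<bullet> a)) *\<^sub>R a \<in> ?F b" "(1 / (b \<bullet> b)) *\<^sub>R b \<in> ?F a"
      by (simp_all only: ab(3))
    then have "a \<bullet> b = a \<bullet> a" "a \<bullet> b = b \<bullet> b"
      using 0 by (simp_all add: field_simps inner_commute)
    then have "(a - b) \<bullet> (a - b) = 0"
      by (simp add: inner_diff inner_commute)
    then show "a = b"
      by simp
  qed
  have sub: "?F ` normals X H \<subseteq> spanned_hyperplanes X H"
    by (auto simp: normals_def)
  show "finite (normals X H)"
    using finite_subset[OF sub finite_spanned[OF assms]] inj by (rule finite_imageD)
  have "spanned_hyperplanes X H \<subseteq> (\<lambda>S. affine hull ((!) X ` S)) ` Pow H"
    by (auto simp: spanned_hyperplanes_def)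
  with sub have "?F ` normals X H \<subseteq> (\<lambda>S. affine hull ((!) X ` S)) ` Pow H"
    by (rule subset_trans)
  then have "card (?F ` normals X H) \<le> card (Pow H)"
    using assms by (intro surj_card_le[OF finite_Pow_iff[THEN iffD2]])
  then show "card (normals X H) \<le> 2 ^ card H"
    using assms by (simp add: card_image[OF inj] card_Pow)
qed

lemma sqdist_nonneg [simp]: "0 \<le> sqdist X a i"
  by (simp add: sqdist_def)

lemma sqdist_eq_infdist:
  "a \<noteq> 0 \<Longrightarrow> sqdist X a i = (infdist (X ! i) {x. x \<bullet> a = 1})\<^sup>2"
  using infdist_hyperplane[of a "X ! i" 1]
  by (simp add: sqdist_def inner_commute power_divide)

lemma finite_closest [simp]: "finite (closest X h a)"
  by (simp add: closest_def)

lemma card_closest: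
  assumes "0 < h" "h \<le> length X"
  shows "h \<le> card (closest X h a)"
  using card_sort_nth(1)[OF assms, of "sqdist X a"]
  by (simp add: closest_def sqdist_order_stat_def)

text \<open>Fewer than \<open>h\<close> indices lie strictly below the order statistic, so
  \<open>H\<close> is too large to consist of them only.\<close>

lemma order_stat_le:
  assumes "0 < h" "h \<le> length X" "H \<subseteq> {..<length X}" "h \<le> card H"
  obtains i where "i \<in> H" "sqdist_order_stat X h a \<le> sqdist X a i"
proof (rule ccontr)
  assume no: "\<not> thesis"
  have "sqdist X a i < sqdist_order_stat X h a" if "i \<in> H" for i
    by (rule ccontr) (use no that \<open>\<And>i. i \<in> H \<Longrightarrow> _ \<Longrightarrow> thesis\<close> in \<open>simp add: not_less\<close>)
  then have "H \<subseteq> {i. i < length X \<and> sqdist X a i < sqdist_order_stat X h a}"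
    using assms(3) by auto
  then have "card H < h"
    using card_mono[of "{i. i < length X \<and> sqdist X a i < sqdist_order_stat X h a}" H]
      card_sort_nth(2)[OF assms(1,2), of "sqdist X a"]
    by (simp add: sqdist_order_stat_def)
  then show False
    using assms(4) by simp
qed

lemma ave_le:
  assumes "finite A" "A \<noteq> {}" "\<And>i. i \<in> A \<Longrightarrow> f i \<le> B"
  shows "ave f A \<le> B"
  using sum_bounded_above[of A f B] assms card_gt_0_iff[of A]
  by (simp add: ave_def field_simps)

lemma le_ave:
  assumes "finite A" "i \<in> A" "card A \<le> m" "\<And>j. 0 \<le> f j"
  shows "f i / real m \<le> ave f A"
proof -
  have "f i \<le> sum f A"
    using assms by (intro member_le_sum) auto
  moreover have "card A > 0"
    using assms card_gt_0_iff by blast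
  ultimately show ?thesis
    unfolding ave_def using assms by (intro frac_le) (auto intro: sum_nonneg)
qed

lemma ave_closest_le:
  assumes "0 < h" "h \<le> length X"
  shows "ave (sqdist X a) (closest X h a) \<le> sqdist_order_stat X h a"
proof (rule ave_le)
  show "closest X h a \<noteq> {}"
    using card_closest[OF assms, of a] assms(1) by force
qed (auto simp: closest_def)

text \<open>Ties can make \<open>closest X h a\<close> larger than \<open>h\<close>, so that the index may be negative.\<close>

lemma incongruence_along_ge:
  assumes h: "0 < h" and H: "H \<in> h_subsets X h"
  shows "ereal (- ln (real (length X))) \<le> incongruence_along X h H a"
proof -
  let ?n = "real (length X)"
  define x y where "x = ave (sqdist X a) H" and "y = ave (sqdist X a) (closest X h a)"
  have H': "H \<subseteq> {..<length X}" "card H = h"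
    using H by (auto simp: h_subsets_def)
  have fin: "finite H" "h \<le> length X"
    using H' finite_subset card_mono[of "{..<length X}" H] by auto
  obtain i where i: "i \<in> H" "sqdist_order_stat X h a \<le> sqdist X a i"
    using order_stat_le[OF h fin(2) H'(1)] H'(2) by blast
  have n: "?n \<ge> 1"
    using h fin by simp
  have "y \<le> sqdist X a i"
    using ave_closest_le[OF h fin(2), of a] i(2) by (simp add: y_def)
  also have "sqdist X a i \<le> ?n * x"
    using le_ave[OF fin(1) i(1), of "length X" "sqdist X a"] H'(2) fin(2) n
    by (simp add: x_def pos_divide_le_eq mult.commute del: length_greater_0_conv)
  finally have le: "y \<le> ?n * x" .
  have nonneg: "0 \<le> x" "0 \<le> y"
    by (simp_all add: x_def y_def ave_def sum_nonneg)
  have "ereal (- ln ?n) \<le> log_ratio x y"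
  proof (cases "x = 0 \<or> y = 0")
    case True
    \<comment> \<open>By \<open>y \<le> ?n * x\<close>, \<open>x = 0\<close> forces
      \<open>y = 0\<close>, so the value \<open>-\<infinity>\<close> does not occur.\<close>
    then show ?thesis
      using le nonneg n by (auto simp: log_ratio_def)
  next
    case False
    then have "1 / ?n \<le> x / y"
      using le nonneg n by (simp add: divide_le_eq le_divide_eq mult.commute)
    then have "ln (1 / ?n) \<le> ln (x / y)"
      using n False nonneg by (subst ln_le_cancel_iff) auto
    then show ?thesis
      using False n by (auto simp: log_ratio_def ln_div split: if_splits)
  qed
  then show ?thesis
    by (simp add: incongruence_along_def x_def y_def)
qed


section \<open>Few contaminated observations\<close>

text \<open>For genuine subsets the numerator is at most \<open>D\<^sup>2\<close> and the
  denominator at least \<open>\<delta>\<^sup>2 / n\<close>. The summand 1 makes the logarithm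
  nonnegative, so that the bound also covers an empty average.\<close>

definition incongruence_bound :: "nat \<Rightarrow> real \<Rightarrow> real \<Rightarrow> real" where
  "incongruence_bound n \<delta> D = ln (1 + real n * D\<^sup>2 / \<delta>\<^sup>2)"

text \<open>The exponent bounds the index along one normal: there are at most \<open>2 ^ n\<close>
  normals, each with index at least \<open>- ln n\<close>. Its exponential times
  \<open>D\<^sup>2\<close> bounds the mean squared distance over the optimal subset; the factor
  \<open>n\<close> passes from the mean to a single row.\<close>

definition facet_dist_bound :: "nat \<Rightarrow> real \<Rightarrow> real \<Rightarrow> real" where
  "facet_dist_bound n \<delta> D =
     sqrt (real n * (exp (2 ^ n * (incongruence_bound n \<delta> D + ln (real n))) * D\<^sup>2))"

text \<open>The simplex estimate with weights at most
  \<open>facet_dist_bound n \<delta> D / \<delta>\<close>, edges at most \<open>D\<close> and at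
  most \<open>n\<close> vertices.\<close>

definition pcs_radius :: "nat \<Rightarrow> real \<Rightarrow> real \<Rightarrow> real" where
  "pcs_radius n \<delta> D = real n * (facet_dist_bound n \<delta> D / \<delta> * D)"

text \<open>\<open>G\<close> is the set of indices of the genuine observations.\<close>

locale mostly_genuine =
  fixes Z :: "(real ^ 'p) list" and G :: "nat set" and h :: nat and \<delta> D :: real
  assumes G: "G \<subseteq> {..<length Z}" "h \<le> card G"
    and h: "length Z + CARD('p) + 1 \<le> 2 * h"
    and general: "\<And>A. affine A \<Longrightarrow> aff_dim A = int CARD('p) - 1 \<Longrightarrow>
                   card {i \<in> G. Z ! i \<in> A} \<le> CARD('p)"
    and \<delta>: "\<delta> > 0"
    and gap: "\<And>S i. S \<subseteq> G \<Longrightarrow> S \<noteq> {} \<Longrightarrow> i \<in> G \<Longrightarrow> Z ! i \<notin> affine hull ((!) Z ` S) \<Longrightarrow>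
               \<delta> \<le> infdist (Z ! i) (affine hull ((!) Z ` S))"
    and diam: "\<And>i j. i \<in> G \<Longrightarrow> j \<in> G \<Longrightarrow> dist (Z ! i) (Z ! j) \<le> D"
begin

abbreviation "n \<equiv> length Z"

lemma finite_G [simp]: "finite G"
  using G(1) finite_subset by blast

lemma h_le_n: "h \<le> n"
  using G card_mono[of "{..<n}" G] by simp

lemma h_pos: "0 < h"
  using h by simp

lemma n_pos: "0 < n"
  using h_pos h_le_n by linarith

text \<open>Inclusion-exclusion leaves at least \<open>2 * h - n\<close> common indices; the size of
  \<open>h\<close> makes this at least \<open>CARD('p) + 1\<close>, the number of vertices of a
  simplex.\<close>

lemma card_Int_G:
  assumes "H \<subseteq> {..<n}" "h \<le> card H"
  shows "CARD('p) < card (H \<inter> G)"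
proof -
  have "finite H"
    using assms(1) finite_subset by blast
  then have "card (H \<union> G) + card (H \<inter> G) = card H + card G"
    using card_Un_Int[of H G] by simp
  moreover have "card (H \<union> G) \<le> n"
    using card_mono[of "{..<n}" "H \<union> G"] assms(1) G(1) by simp
  ultimately show ?thesis
    using assms(2) G(2) h by linarith
qed

lemma not_subset_hyperplane:
  assumes "T \<subseteq> G" "CARD('p) < card T" "affine A" "aff_dim A = int CARD('p) - 1"
  shows "\<exists>i\<in>T. Z ! i \<notin> A"
proof (rule ccontr)
  assume "\<not> ?thesis"
  then have "T \<subseteq> {i \<in> G. Z ! i \<in> A}"
    using assms(1) by auto
  from card_mono[OF _ this] general[OF assms(3,4)] assms(2) show False
    by simp
qed

lemma normals_hyperplane:
  assumes "a \<in> normals Z H"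
  shows "affine {x. x \<bullet> a = 1}" "aff_dim {x. x \<bullet> a = 1} = int CARD('p) - 1"
  using assms affine_hyperplane[of a 1]
  by (auto simp: normals_def spanned_hyperplanes_def inner_commute)

text \<open>General position excludes a hyperplane through all of \<open>T\<close>, so its points
  span the space. Removing a vertex lowers the dimension by at most one, and the remaining
  \<open>CARD('p)\<close> points cannot span more than a hyperplane.\<close>

lemma simplex:
  assumes T: "T \<subseteq> G" "card T = CARD('p) + 1"
  shows "affine hull ((!) Z ` T) = UNIV"
    and "s \<in> T \<Longrightarrow> aff_dim ((!) Z ` (T - {s})) = int CARD('p) - 1"
proof -
  have fin: "finite T"
    using T(1) finite_G finite_subset by blast
  have "\<not> aff_dim ((!) Z ` T) < int (DIM(real ^ 'p))"
  proof
    assume "aff_dim ((!) Z ` T) < int (DIM(real ^ 'p))"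
    then obtain a b where ab: "a \<noteq> 0" "(!) Z ` T \<subseteq> {x. a \<bullet> x = b}"
      by (rule aff_lowdim_subset_hyperplane)
    have "aff_dim {x. a \<bullet> x = b} = int CARD('p) - 1"
      using aff_dim_hyperplane[OF ab(1), of b] by simp
    then show False
      using not_subset_hyperplane[OF T(1) _ affine_hyperplane[of a b]] T(2) ab(2) by auto
  qed
  then have dim: "aff_dim ((!) Z ` T) = int (DIM(real ^ 'p))"
    using aff_dim_le_DIM[of "(!) Z ` T"] by linarith
  then show "affine hull ((!) Z ` T) = UNIV"
    by (simp only: aff_dim_eq_full)
  assume s: "s \<in> T"
  let ?S = "(!) Z ` (T - {s})"
  have "(!) Z ` T = insert (Z ! s) ?S"
    using s by blast
  then have "aff_dim ((!) Z ` T) \<le> aff_dim ?S + 1"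
    by (simp add: aff_dim_insert)
  moreover have "aff_dim ?S \<le> int (card ?S) - 1"
    using aff_dim_le_card[of ?S] fin by simp
  moreover have "card ?S \<le> CARD('p)"
    using card_image_le[of "T - {s}" "(!) Z"] fin T(2) s by simp
  ultimately show "aff_dim ?S = int CARD('p) - 1"
    using dim by simp
qed

text \<open>Among the at least \<open>h\<close> closest indices more than \<open>CARD('p)\<close>
  are genuine, so one of these lies off the hyperplane, at distance at least \<open>\<delta>\<close>
  because genuine points span it. Contamination thus cannot push the denominator of the index to
  0.\<close>

lemma ave_closest_ge:
  assumes S: "S \<subseteq> G" "S \<noteq> {}" and a: "a \<noteq> 0" and dim: "aff_dim {x. x \<bullet> a = 1} = int CARD('p) - 1"
    and F: "{x. x \<bullet> a = 1} = affine hull ((!) Z ` S)"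
  shows "\<delta>\<^sup>2 / real n \<le> ave (sqdist Z a) (closest Z h a)"
proof -
  let ?C = "closest Z h a"
  have C: "?C \<subseteq> {..<n}" "h \<le> card ?C"
    using card_closest[OF h_pos h_le_n] by (auto simp: closest_def)
  obtain i where i: "i \<in> ?C \<inter> G" "Z ! i \<notin> {x. x \<bullet> a = 1}"
    using not_subset_hyperplane[of "?C \<inter> G", OF _ card_Int_G[OF C] _ dim] affine_hyperplane[of a 1]
    by (auto simp: inner_commute)
  then have "\<delta> \<le> infdist (Z ! i) {x. x \<bullet> a = 1}"
    using gap[OF S, of i] unfolding F by blast
  then have "\<delta>\<^sup>2 \<le> sqdist Z a i"
    using \<delta> by (simp add: sqdist_eq_infdist[OF a] power_mono)
  then have "\<delta>\<^sup>2 / real n \<le> sqdist Z a i / real n"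
    by (simp add: divide_right_mono)
  also have "\<dots> \<le> ave (sqdist Z a) ?C"
    using i C card_mono[OF _ C(1)] by (intro le_ave) auto
  finally show ?thesis .
qed

lemma sqdist_genuine_le:
  assumes S: "S \<subseteq> G" "S \<noteq> {}" and a: "a \<noteq> 0" and i: "i \<in> G"
    and F: "{x. x \<bullet> a = 1} = affine hull ((!) Z ` S)"
  shows "sqdist Z a i \<le> D\<^sup>2"
proof -
  obtain s where s: "s \<in> S"
    using S(2) by blast
  then have "Z ! s \<in> {x. x \<bullet> a = 1}"
    unfolding F by (intro hull_inc) auto
  then have "infdist (Z ! i) {x. x \<bullet> a = 1} \<le> D"
    using diam[OF i, of s] s S(1) by (intro infdist_le2) auto
  then show ?thesis
    by (simp add: sqdist_eq_infdist[OF a] power_mono infdist_nonneg)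
qed

text \<open>Every normal of a genuine subset comes from genuine points, so the numerator and
  denominator bounds both apply. This is the benchmark for the optimal subset.\<close>

lemma incongruence_genuine_le:
  assumes H: "H \<in> h_subsets Z h" "H \<subseteq> G"
  shows "incongruence Z h H \<le> ereal (incongruence_bound n \<delta> D)"
  unfolding incongruence_def
proof (rule ereal_average_le)
  show "0 \<le> incongruence_bound n \<delta> D"
    by (simp add: incongruence_bound_def)
  fix a assume aH: "a \<in> normals Z H"
  then obtain S where S: "S \<subseteq> H" "card S = CARD('p)" "{x. x \<bullet> a = 1} = affine hull ((!) Z ` S)"
    by (auto simp: normals_def spanned_hyperplanes_def)
  have S': "S \<subseteq> G" "S \<noteq> {}"
    using S H(2) by auto
  note a = normals_nonzero[OF aH]
  have H': "finite H" "H \<noteq> {}"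
    using H h_pos finite_subset[OF H(2)] by (auto simp: h_subsets_def)
  define x y where "x = ave (sqdist Z a) H" and "y = ave (sqdist Z a) (closest Z h a)"
  have x: "0 \<le> x" "x \<le> D\<^sup>2"
    using sqdist_genuine_le[OF S' a _ S(3)] H(2) H'
    by (auto simp: x_def ave_def[of _ H] sum_nonneg intro!: ave_le[unfolded ave_def])
  have y: "\<delta>\<^sup>2 / real n \<le> y"
    using ave_closest_ge[OF S' a normals_hyperplane(2)[OF aH] S(3)] by (simp add: y_def)
  have y0: "y > 0"
    using y \<delta> n_pos by (smt (verit) divide_pos_pos of_nat_0_less_iff zero_less_power)
  have "log_ratio x y \<le> ereal (ln (1 + real n * D\<^sup>2 / \<delta>\<^sup>2))"
  proof (cases "x = 0")
    case True
    then show ?thesis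
      using y0 by (simp add: log_ratio_def)
  next
    case False
    have "x / y \<le> D\<^sup>2 / (\<delta>\<^sup>2 / real n)"
      using x y \<delta> n_pos by (intro frac_le) auto
    then have "x / y \<le> 1 + real n * D\<^sup>2 / \<delta>\<^sup>2"
      by (simp add: mult.commute)
    then have "ln (x / y) \<le> ln (1 + real n * D\<^sup>2 / \<delta>\<^sup>2)"
      using False x y0 by (subst ln_le_cancel_iff) (auto intro: add_pos_nonneg)
    then show ?thesis
      using False y0 by (simp add: log_ratio_def)
  qed
  then show "incongruence_along Z h H a \<le> ereal (incongruence_bound n \<delta> D)"
    by (simp add: incongruence_along_def x_def y_def incongruence_bound_def)
qed

text \<open>Optimality bounds the average index, and the lower bound along the other normals turns
  this into a bound along \<open>a\<close>. As the denominator is at most \<open>D\<^sup>2\<close>,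
  the numerator is bounded, and with it each distance in \<open>H\<close>.\<close>

lemma optimal_near_facet:
  assumes opt: "optimal_subset Z h H" and a: "a \<in> normals Z H" and i: "i \<in> H"
    and S: "S \<subseteq> G" "S \<noteq> {}" and F: "{x. x \<bullet> a = 1} = affine hull ((!) Z ` S)"
  shows "\<bar>a \<bullet> (Z ! i) - 1\<bar> \<le> facet_dist_bound n \<delta> D * norm a"
proof -
  let ?U = "incongruence_bound n \<delta> D"
  have H: "H \<in> h_subsets Z h"
    using opt by (simp add: optimal_subset_def is_arg_min_def)
  then have H': "H \<subseteq> {..<n}" "card H = h" "finite H"
    using finite_subset by (auto simp: h_subsets_def)
  obtain K where K: "K \<subseteq> G" "card K = h"
    using obtain_subset_with_card_n[OF G(2)] by metis
  then have "K \<in> h_subsets Z h"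
    using G(1) by (auto simp: h_subsets_def)
  then have "incongruence Z h H \<le> ereal ?U"
    using opt incongruence_genuine_le[of K] K(1)
    by (force simp: optimal_subset_def is_arg_min_linorder)
  moreover have "card (normals Z H) \<le> 2 ^ n"
    using card_normals_le(2)[OF H'(3), of Z] H'(2) h_le_n
    by (meson le_trans one_le_numeral power_increasing)
  ultimately have inc: "incongruence_along Z h H a \<le> ereal (real (2 ^ n) * (?U + ln (real n)))"
    using incongruence_along_ge[OF h_pos H] card_normals_le(1)[OF H'(3), of Z] n_pos a
    unfolding incongruence_def
    by (intro le_ereal_average[where A = "normals Z H"])
      (auto simp: incongruence_bound_def Suc_le_eq)
  note a0 = normals_nonzero[OF a]
  define V where "V = 2 ^ n * (?U + ln (real n))"
  define x y where "x = ave (sqdist Z a) H" and "y = ave (sqdist Z a) (closest Z h a)"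
  have "\<delta>\<^sup>2 / real n \<le> y"
    using ave_closest_ge[OF S a0 normals_hyperplane(2)[OF a] F] by (simp add: y_def)
  then have y0: "y > 0"
    using \<delta> n_pos by (smt (verit) divide_pos_pos of_nat_0_less_iff zero_less_power)
  \<comment> \<open>\<open>G\<close> has at least \<open>h\<close> indices, so the order statistic
    does not exceed some genuine distance.\<close>
  obtain j where "j \<in> G" "sqdist_order_stat Z h a \<le> sqdist Z a j"
    using order_stat_le[OF h_pos h_le_n G(1) G(2)] by blast
  then have y: "y \<le> D\<^sup>2"
    using ave_closest_le[OF h_pos h_le_n, of a] sqdist_genuine_le[OF S a0 _ F, of j]
    by (simp add: y_def)
  have "0 \<le> x"
    by (simp add: x_def ave_def sum_nonneg)
  have x: "x \<le> exp V * D\<^sup>2"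
  proof (cases "x = 0")
    case False
    then have "x / y > 0"
      using \<open>0 \<le> x\<close> y0 by simp
    moreover have "ln (x / y) \<le> V"
      using inc False y0
      by (simp add: incongruence_along_def log_ratio_def V_def flip: x_def y_def)
    ultimately have "x / y \<le> exp V"
      by (metis exp_le_cancel_iff exp_ln)
    then have "x \<le> exp V * y"
      using y0 by (simp add: field_simps)
    also have "\<dots> \<le> exp V * D\<^sup>2"
      using y by simp
    finally show ?thesis .
  qed simp
  have "sqdist Z a i \<le> real n * x"
    using le_ave[OF H'(3) i, of n "sqdist Z a"] H'(2) h_le_n n_pos by (simp add: x_def field_simps)
  also have "\<dots> \<le> real n * (exp V * D\<^sup>2)"
    using x by (rule mult_left_mono) simp
  finally have "\<bar>a \<bullet> (Z ! i) - 1\<bar> / norm a \<le> sqrt (real n * (exp V * D\<^sup>2))"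
    by (intro real_le_rsqrt) (simp add: sqdist_def power_divide)
  then show ?thesis
    using a0 by (simp add: facet_dist_bound_def V_def field_simps)
qed

text \<open>\<open>H\<close> contains the vertices of a genuine simplex, and each facet yields a
  normal of \<open>H\<close>. So row \<open>i\<close>, possibly contaminated, is close to all facet
  hyperplanes, which bounds its distance from a vertex.\<close>

lemma optimal_near_genuine:
  assumes N: "normalizable Z" and opt: "optimal_subset Z h H" and i: "i \<in> H"
  shows "\<exists>j\<in>G. dist (Z ! i) (Z ! j) \<le> pcs_radius n \<delta> D"
proof -
  let ?r = "facet_dist_bound n \<delta> D"
  have H: "H \<subseteq> {..<n}" "card H = h"
    using opt by (simp_all add: optimal_subset_def is_arg_min_def h_subsets_def)
  have "CARD('p) + 1 \<le> card (H \<inter> G)"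
    using card_Int_G[of H] H by simp
  then obtain T where T: "T \<subseteq> H \<inter> G" "card T = CARD('p) + 1" "finite T"
    by (rule obtain_subset_with_card_n)
  then obtain v where v: "v \<in> T"
    by fastforce
  have TG: "T \<subseteq> G"
    using T(1) by simp
  have "dist (Z ! i) (Z ! v) \<le> real (card ((!) Z ` T)) * (?r / \<delta> * D)"
  proof (rule dist_simplex_vertex_le)
    show "finite ((!) Z ` T)" "Z ! v \<in> (!) Z ` T" "\<delta> > 0" "Z ! i \<in> affine hull ((!) Z ` T)"
      using T(3) v \<delta> simplex(1)[OF TG T(2)] by auto
    show "dist s (Z ! v) \<le> D" if "s \<in> (!) Z ` T" for s
      using that v TG diam by auto
    fix s' assume "s' \<in> (!) Z ` T"
    then obtain s where s: "s \<in> T" "s' = Z ! s"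
      by blast
    let ?S = "T - {s}"
    define F where "F = affine hull ((!) Z ` ?S)"
    have cS: "card ?S = CARD('p)"
      using s T by simp
    then have "card ?S > 0"
      by simp
    then have S: "?S \<subseteq> G" "?S \<noteq> {}"
      using TG by (auto simp only: card_gt_0_iff)
    have dim: "aff_dim F = int CARD('p) - 1"
      using simplex(2)[OF TG T(2) s(1)] by (simp add: F_def)
    then have "aff_dim ((!) Z ` ?S) = int (DIM(real ^ 'p)) - 1"
      by (simp add: F_def)
    then obtain c b where cb: "c \<noteq> 0" "F = {x. c \<bullet> x = b}"
      unfolding F_def aff_dim_eq_hyperplane[of "(!) Z ` ?S", symmetric]
      using aff_dim_eq_hyperplane[of "(!) Z ` ?S"] by auto
    have FH: "F \<in> spanned_hyperplanes Z H"
      unfolding spanned_hyperplanes_def mem_Collect_eq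
      using T(1) cS dim by (intro exI[of _ ?S] conjI) (auto simp: F_def simp del: aff_dim_affine_hull)
    then have "F \<in> spanned_hyperplanes Z {..<n}"
      using spanned_mono[OF H(1)] by blast
    \<comment> \<open>\<open>normalizable\<close> keeps the hyperplane off the origin, so its
      equation can be scaled to right-hand side 1.\<close>
    then have "b \<noteq> 0"
      using N cb(2) by (auto simp: normalizable_def)
    define a where "a = (1 / b) *\<^sub>R c"
    have Fa: "{x. x \<bullet> a = 1} = F"
      using \<open>b \<noteq> 0\<close> by (auto simp: cb(2) a_def inner_commute field_simps)
    then have a: "a \<in> normals Z H"
      using FH by (simp add: normals_def)
    note a0 = normals_nonzero[OF a]
    have inF: "Z ! j \<in> F" if "j \<in> ?S" for j
      unfolding F_def using that by (intro hull_inc) auto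
    have "affine F"
      by (simp add: F_def)
    \<comment> \<open>Not all vertices lie on \<open>F\<close>, but those other than
      \<open>s\<close> do; so \<open>s\<close> is the one off it.\<close>
    then obtain j where "j \<in> T" "Z ! j \<notin> F"
      using not_subset_hyperplane[OF TG _ _ dim] T(2) by auto
    then have "Z ! s \<notin> F"
      using inF by blast
    then have "\<delta> \<le> infdist (Z ! s) F"
      unfolding F_def using S s(1) TG by (intro gap) auto
    moreover have "F = {x. a \<bullet> x = 1}"
      using Fa by (simp add: inner_commute)
    ultimately have "\<delta> * norm a \<le> \<bar>a \<bullet> s' - 1\<bar>"
      using a0 s(2) by (simp add: infdist_hyperplane field_simps)
    moreover have "(!) Z ` T - {s'} \<subseteq> {x. a \<bullet> x = 1}"
      using inF s(2) \<open>F = {x. a \<bullet> x = 1}\<close> by auto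
    moreover have "\<bar>a \<bullet> (Z ! i) - 1\<bar> \<le> ?r * norm a"
      using optimal_near_facet[OF opt a i S] Fa by (simp add: F_def)
    ultimately show "\<exists>a b. a \<noteq> 0 \<and> (!) Z ` T - {s'} \<subseteq> {x. a \<bullet> x = b} \<and>
        \<delta> * norm a \<le> \<bar>a \<bullet> s' - b\<bar> \<and> \<bar>a \<bullet> (Z ! i) - b\<bar> \<le> ?r * norm a"
      using a0 by blast
  qed
  also have "\<dots> \<le> real n * (?r / \<delta> * D)"
  proof (rule mult_right_mono)
    have "card ((!) Z ` T) \<le> card T"
      using T(3) by (rule card_image_le)
    also have "card T \<le> n"
      using card_mono[of "{..<n}" T] T(1) H(1) by auto
    finally show "real (card ((!) Z ` T)) \<le> real n"
      by simp
    have "0 \<le> D"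
      using diam[of v v] v TG by auto
    then show "0 \<le> ?r / \<delta> * D"
      using \<delta> by (simp add: facet_dist_bound_def)
  qed
  finally show ?thesis
    using v TG by (auto simp: pcs_radius_def)
qed

text \<open>The exact-fit clause never applies: a hyperplane through \<open>h\<close> observations would contain more
  than \<open>p\<close> genuine ones.\<close>

lemma pcs_near_genuine:
  assumes N: "normalizable Z" and pcs: "pcs_subset Z h H" and i: "i \<in> H"
  shows "\<exists>j\<in>G. dist (Z ! i) (Z ! j) \<le> pcs_radius n \<delta> D"
proof -
  have "\<not> h \<le> card (exact_fit Z a)" if a: "a \<in> normals Z H0" for a H0
  proof
    assume "h \<le> card (exact_fit Z a)"
    moreover have "exact_fit Z a \<subseteq> {..<n}"
      by (auto simp: exact_fit_def)
    ultimately have "CARD('p) < card (exact_fit Z a \<inter> G)"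
      by (intro card_Int_G)
    then obtain j where j: "j \<in> exact_fit Z a" "Z ! j \<notin> {x. x \<bullet> a = 1}"
      using not_subset_hyperplane[of "exact_fit Z a \<inter> G", OF _ _ normals_hyperplane[OF a]] by auto
    then show False
      using normals_nonzero[OF a] by (auto simp: exact_fit_def sqdist_def inner_commute)
  qed
  then have "optimal_subset Z h H"
    using pcs unfolding pcs_subset_def by metis
  then show ?thesis
    using optimal_near_genuine[OF N _ i] by blast
qed

end


section \<open>The breakdown point\<close>

text \<open>Averaging commutes with translation, so the auxiliary origin \<open>z\<close> cancels
  and can enter only through the selection of \<open>H\<close>.\<close>

lemma pcs_location_estimator_mean:
  fixes t :: "(real ^ 'p) list \<Rightarrow> real ^ 'p"
  assumes t: "pcs_location_estimator (length Y) h t" and h: "0 < h"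
  obtains z H where "normalizable (shift z Y)" "pcs_subset (shift z Y) h H"
    "t Y = (1 / real (card H)) *\<^sub>R (\<Sum>i\<in>H. Y ! i)"
proof -
  obtain z H where z: "normalizable (shift z Y)" "pcs_subset (shift z Y) h H"
    "t Y - z = (1 / real (card H)) *\<^sub>R (\<Sum>i\<in>H. shift z Y ! i)"
    using t unfolding pcs_location_estimator_def pcs_location_def by blast
  note H = pcs_subset_card[OF z(2)]
  have c: "card H > 0"
    using H(2) h by simp
  have "(\<Sum>i\<in>H. shift z Y ! i) = (\<Sum>i\<in>H. Y ! i - z)"
    by (rule sum.cong) (use H(1) in auto)
  then have "(1 / real (card H)) *\<^sub>R (\<Sum>i\<in>H. shift z Y ! i)
      = (1 / real (card H)) *\<^sub>R (\<Sum>i\<in>H. Y ! i) - z"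
    using c by (simp add: sum_subtractf scaleR_diff_right sum_constant_scaleR del: sum_constant)
  then show thesis
    using that z by auto
qed

text \<open>Affine hulls are closed, so a point outside has positive distance, and only finitely
  many pairs of a point and a subset occur.\<close>

lemma finite_gap:
  fixes P :: "'a::euclidean_space set"
  assumes "finite P"
  obtains \<delta> :: real where "\<delta> > 0"
    "\<And>S x. S \<subseteq> P \<Longrightarrow> S \<noteq> {} \<Longrightarrow> x \<in> P \<Longrightarrow> x \<notin> affine hull S \<Longrightarrow> \<delta> \<le> infdist x (affine hull S)"
proof -
  define E where "E = (\<lambda>(x, S). infdist x (affine hull S)) `
    {(x, S). x \<in> P \<and> S \<subseteq> P \<and> S \<noteq> {} \<and> x \<notin> affine hull S}"
  have "finite E"
    unfolding E_def
    by (intro finite_imageI, rule finite_subset[of _ "P \<times> Pow P"]) (use assms in auto)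
  moreover have "\<forall>e\<in>E. e > 0"
    unfolding E_def by (auto intro!: infdist_pos_not_in_closed)
  ultimately have "Min (insert 1 E) > 0" "\<forall>e\<in>E. Min (insert 1 E) \<le> e"
    by auto
  then obtain \<delta> where "\<delta> > 0" "\<forall>e\<in>E. \<delta> \<le> e"
    by blast
  then show thesis
    using that[of \<delta>] unfolding E_def by fast
qed

text \<open>Multiset inclusion respects multiplicities, so the genuine rows cannot hit
  \<open>A\<close> more often than the rows of \<open>X\<close> do.\<close>

lemma card_corrupted_hyperplane_le:
  fixes X Y :: "(real ^ 'p) list"
  assumes Y: "Y \<in> corrupted X c" and gp: "general_position X"
    and A: "affine A" "aff_dim A = int CARD('p) - 1"
  shows "card {i. i < length X - c \<and> Y ! i \<in> A} \<le> CARD('p)"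
proof -
  let ?g = "length X - c"
  have len: "length Y = length X" and sub: "mset (take ?g Y) \<subseteq># mset X"
    using Y by (auto simp: corrupted_def)
  have "filter_mset (\<lambda>x. x \<in> A) (mset (take ?g Y)) \<subseteq># filter_mset (\<lambda>x. x \<in> A) (mset X)"
    using sub by (rule multiset_filter_mono)
  then have "length (filter (\<lambda>x. x \<in> A) (take ?g Y)) \<le> length (filter (\<lambda>x. x \<in> A) X)"
    using size_mset_mono by (metis mset_filter size_mset)
  also have "\<dots> \<le> CARD('p)"
    using gp A unfolding general_position_def length_filter_conv_card by blast
  finally show ?thesis
    using len by (simp add: length_filter_conv_card cong: conj_cong)
qed

text \<open>The constants \<open>\<delta>\<close>, \<open>D\<close> and \<open>M\<close> are taken
  from the rows of \<open>X\<close> alone, so one bound serves all corrupted data sets and all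
  origins.\<close>

lemma pcs_bias_bounded:
  fixes X :: "(real ^ 'p) list"
  assumes gp: "general_position X" and h: "length X + CARD('p) + 1 \<le> 2 * h"
    and c: "c \<le> length X - h" "h \<le> length X" and t: "pcs_location_estimator (length X) h t"
  shows "bias t X c < \<infinity>"
proof -
  let ?n = "length X"
  define P where "P = set X"
  have P: "finite P"
    by (simp add: P_def)
  obtain \<delta> where \<delta>: "\<delta> > 0"
    "\<And>S x. S \<subseteq> P \<Longrightarrow> S \<noteq> {} \<Longrightarrow> x \<in> P \<Longrightarrow> x \<notin> affine hull S \<Longrightarrow> \<delta> \<le> infdist x (affine hull S)"
    using finite_gap[OF P] by metis
  define D where "D = diameter P"
  have D: "dist x y \<le> D" if "x \<in> P" "y \<in> P" for x y
    using that P by (simp add: D_def diameter_bounded_bound finite_imp_bounded)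
  obtain M where M: "0 < M" "\<And>x. x \<in> P \<Longrightarrow> norm x \<le> M"
    using finite_imp_bounded[OF P] bounded_pos by blast
  define R where "R = pcs_radius ?n \<delta> D"
  have "norm (t Y) \<le> M + \<bar>R\<bar>" if Y: "Y \<in> corrupted X c" for Y
  proof -
    let ?G = "{..<?n - c}"
    have len: "length Y = ?n" and sub: "mset (take (?n - c) Y) \<subseteq># mset X"
      using Y by (auto simp: corrupted_def)
    have YP: "Y ! i \<in> P" if "i \<in> ?G" for i
    proof -
      have "Y ! i \<in> set (take (?n - c) Y)"
        using that len by (auto simp: in_set_conv_nth)
      then show ?thesis
        using set_mset_mono[OF sub] by (auto simp: P_def)
    qed
    obtain z H where z: "normalizable (shift z Y)" "pcs_subset (shift z Y) h H"
      "t Y = (1 / real (card H)) *\<^sub>R (\<Sum>i\<in>H. Y ! i)"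
      using pcs_location_estimator_mean[of Y h t] t h len by auto
    let ?Z = "shift z Y"
    have nth: "?Z ! i = - z + Y ! i" if "i < ?n" for i
      using that len by simp
    have nth_image: "(!) ?Z ` S = (+) (- z) ` ((!) Y ` S)" if "S \<subseteq> ?G" for S
    proof -
      have "(!) ?Z ` S = (\<lambda>i. - z + Y ! i) ` S"
        using that by (intro image_cong refl nth) auto
      then show ?thesis
        by (simp only: image_image)
    qed
    \<comment> \<open>Translation by \<open>- z\<close> preserves distances and dimensions and
      commutes with affine hulls, so the properties of \<open>X\<close> carry over to the shifted
      genuine rows.\<close>
    interpret mostly_genuine ?Z ?G h \<delta> D
    proof
      show "?G \<subseteq> {..<length ?Z}" "h \<le> card ?G" "length ?Z + CARD('p) + 1 \<le> 2 * h" "\<delta> > 0"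
        using len c h \<delta>(1) by auto
      show "dist (?Z ! i) (?Z ! j) \<le> D" if "i \<in> ?G" "j \<in> ?G" for i j
        using that D[OF YP[OF that(1)] YP[OF that(2)]] len by (simp add: dist_norm)
      show "\<delta> \<le> infdist (?Z ! i) (affine hull ((!) ?Z ` S))"
        if S: "S \<subseteq> ?G" "S \<noteq> {}" and i: "i \<in> ?G" and "?Z ! i \<notin> affine hull ((!) ?Z ` S)" for S i
      proof -
        let ?A = "affine hull ((!) Y ` S)"
        have A: "affine hull ((!) ?Z ` S) = (+) (- z) ` ?A"
          using nth_image[OF S(1)] affine_hull_translation[of "- z" "(!) Y ` S"] by simp
        have Zi: "?Z ! i = - z + Y ! i"
          using i by (intro nth) auto
        have "Y ! i \<notin> ?A"
          using that(4) unfolding A Zi by blast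
        then have "\<delta> \<le> infdist (Y ! i) ?A"
          using S YP i by (intro \<delta>(2)) blast+
        then show ?thesis
          unfolding A Zi infdist_translation .
      qed
      show "card {i \<in> ?G. ?Z ! i \<in> A} \<le> CARD('p)"
        if A: "affine A" "aff_dim A = int CARD('p) - 1" for A
      proof -
        have "{i \<in> ?G. ?Z ! i \<in> A} = {i. i < ?n - c \<and> Y ! i \<in> (+) z ` A}"
          using mem_translation[where z = "- z" and S = A] nth by auto
        then show ?thesis
          using card_corrupted_hyperplane_le[OF Y gp, of "(+) z ` A"] A affine_translation[of A z]
          by (simp add: aff_dim_translation_eq)
      qed
    qed
    \<comment> \<open>Each averaged row is within \<open>R\<close> of a genuine row;
      \<open>\<bar>R\<bar>\<close> makes the bound nonnegative, as \<open>norm_mean_le\<close>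
      requires.\<close>
    have "norm (Y ! i) \<le> M + \<bar>R\<bar>" if i: "i \<in> H" for i
    proof -
      obtain j where j: "j \<in> ?G" "dist (?Z ! i) (?Z ! j) \<le> R"
        using pcs_near_genuine[OF z(1,2) i] len by (auto simp: R_def)
      have "i < ?n"
        using pcs_subset_card(1)[OF z(2)] i len by auto
      then have "dist (Y ! i) (Y ! j) \<le> R"
        using j len by (simp add: dist_norm)
      moreover have "norm (Y ! j) \<le> M"
        using M(2) YP j(1) by blast
      moreover have "norm (Y ! i) \<le> norm (Y ! j) + dist (Y ! i) (Y ! j)"
        by (metis dist_norm norm_triangle_sub)
      ultimately show ?thesis
        by linarith
    qed
    then show ?thesis
      unfolding z(3) using M(1) by (intro norm_mean_le) auto
  qed
  then have "norm (t Y - t X) \<le> M + \<bar>R\<bar> + norm (t X)" if "Y \<in> corrupted X c" for Y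
    using that norm_triangle_ineq4[of "t Y" "t X"] by force
  then have "bias t X c \<le> ereal (M + \<bar>R\<bar> + norm (t X))"
    unfolding bias_def by (intro SUP_least) simp
  then show ?thesis
    by (rule le_less_trans) simp
qed

text \<open>With only \<open>h - 1\<close> genuine observations left, every PCS subset contains a contaminated one;
  all contaminated observations are placed at the same remote point.\<close>

lemma pcs_bias_infinite:
  fixes X :: "(real ^ 'p) list"
  assumes h: "0 < h" "h \<le> length X" and t: "pcs_location_estimator (length X) h t"
  shows "bias t X (length X - h + 1) = \<infinity>"
proof -
  let ?n = "length X"
  let ?c = "?n - h + 1"
  define B where "B = (\<Sum>i<?n. norm (X ! i))"
  have "ereal b \<le> bias t X ?c" for b :: real
  proof -
    \<comment> \<open>Averaging divides by at most \<open>?n\<close>, and the genuine rows cancel at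
      most \<open>B\<close>; the norm of \<open>v\<close> makes up for both and leaves
      \<open>\<bar>b\<bar> + norm (t X)\<close>.\<close>
    obtain v :: "real ^ 'p" where v: "norm v = real ?n * (\<bar>b\<bar> + norm (t X)) + B"
      using vector_choose_size[of "real ?n * (\<bar>b\<bar> + norm (t X)) + B"]
      by (metis B_def add_nonneg_nonneg norm_ge_zero abs_ge_zero of_nat_0_le_iff sum_nonneg zero_le_mult_iff)
    define Y where "Y = take (h - 1) X @ replicate ?c v"
    have len: "length Y = ?n"
      using h by (simp add: Y_def)
    have "take (?n - ?c) Y = take (h - 1) X"
      using h by (simp add: Y_def)
    moreover have "mset (take (h - 1) X) \<subseteq># mset X"
      by (metis append_take_drop_id mset_append mset_subset_eq_add_left)
    ultimately have Y: "Y \<in> corrupted X ?c"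
      using len by (simp add: corrupted_def)
    have genuine: "Y ! i = X ! i" if "i < h - 1" for i
      using that h by (simp add: Y_def nth_append)
    have contaminated: "Y ! i = v" if "h - 1 \<le> i" "i < ?n" for i
      using that h by (simp add: Y_def nth_append less_Suc_eq_le del: replicate_Suc)
    obtain z H where z: "pcs_subset (shift z Y) h H"
      "t Y = (1 / real (card H)) *\<^sub>R (\<Sum>i\<in>H. Y ! i)"
      using pcs_location_estimator_mean[of Y h t] t h(1) len by metis
    have H: "H \<subseteq> {..<?n}" "h \<le> card H"
      using pcs_subset_card[OF z(1)] len by simp_all
    have fin: "finite H"
      using H(1) finite_subset by blast
    define G C where "G = H \<inter> {..<h - 1}" and "C = H - {..<h - 1}"
    have "card G \<le> h - 1"
      using card_mono[of "{..<h - 1}" G] by (simp add: G_def)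
    moreover have "card H = card G + card C"
      using fin by (simp add: G_def C_def card_Int_Diff)
    ultimately have C: "1 \<le> card C"
      using H(2) h by linarith
    have "(\<Sum>i\<in>H. Y ! i) = (\<Sum>i\<in>G. Y ! i) + (\<Sum>i\<in>C. Y ! i)"
      using fin by (simp add: G_def C_def sum.Int_Diff[symmetric])
    also have "(\<Sum>i\<in>C. Y ! i) = (\<Sum>i\<in>C. v)"
      using contaminated H(1) by (intro sum.cong) (auto simp: C_def)
    also have "(\<Sum>i\<in>C. v) = real (card C) *\<^sub>R v"
      by (rule sum_constant_scaleR)
    finally have sum: "(\<Sum>i\<in>H. Y ! i) = (\<Sum>i\<in>G. Y ! i) + real (card C) *\<^sub>R v" .
    have "norm (\<Sum>i\<in>G. Y ! i) \<le> (\<Sum>i\<in>G. norm (X ! i))"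
      using genuine by (intro sum_norm_le) (auto simp: G_def)
    also have "\<dots> \<le> B"
      unfolding B_def using H(1) by (intro sum_mono2) (auto simp: G_def)
    finally have "norm v - B \<le> norm (\<Sum>i\<in>H. Y ! i)"
    proof -
      assume *: "norm (\<Sum>i\<in>G. Y ! i) \<le> B"
      \<comment> \<open>The contaminated rows coincide, so they cannot cancel one another.\<close>
      have "norm v \<le> norm (real (card C) *\<^sub>R v)"
        using C mult_right_mono[of 1 "real (card C)" "norm v"] by simp
      also have "\<dots> \<le> norm (\<Sum>i\<in>H. Y ! i) + norm (\<Sum>i\<in>G. Y ! i)"
        unfolding sum by (metis add.commute norm_diff_ineq diff_le_eq)
      finally show ?thesis
        using * by simp
    qed
    then have "real ?n * (\<bar>b\<bar> + norm (t X)) \<le> real (card H) * norm (t Y)"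
      using H(2) h(1) by (simp add: z(2) v)
    also have "\<dots> \<le> real ?n * norm (t Y)"
      using card_mono[OF _ H(1)] by (intro mult_right_mono) auto
    finally have "\<bar>b\<bar> + norm (t X) \<le> norm (t Y)"
      using h by (auto simp: mult_le_cancel_left)
    then have "b \<le> norm (t Y - t X)"
      using norm_triangle_ineq2[of "t Y" "t X"] by linarith
    also have "ereal (norm (t Y - t X)) \<le> bias t X ?c"
      unfolding bias_def using Y by (rule SUP_upper)
    finally show ?thesis
      by simp
  qed
  then show ?thesis
    by (rule ereal_top)
qed

theorem theorem2:
  fixes X :: "(real ^ 'p) list"
    and t :: "(real ^ 'p) list \<Rightarrow> real ^ 'p"
    and n h :: nat
  assumes "n = length X"
    and "n > CARD('p) + 1"
    and "CARD('p) + 1 > 2"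
    and "h = nat \<lceil>(real n + real CARD('p) + 1) / 2\<rceil>"
    and "general_position X"
    and "bdd_above ((\<lambda>a. Max ((\<lambda>i. ((X ! i \<bullet> a) / norm a)\<^sup>2) ` {..<n})) ` {a. a \<noteq> 0})"
    and "\<And>i j. i < j \<Longrightarrow> j < n \<Longrightarrow> norm (X ! i - X ! j) > 0"
    and "pcs_location_estimator n h t"
  shows "breakdown_point t X = (real n - real h + 1) / real n"
proof -
  have "(real n + real CARD('p) + 1) / 2 \<le> real h"
    unfolding assms(4) by (rule real_nat_ceiling_ge)
  moreover have "h \<le> n"
    unfolding assms(4) nat_ceiling_le_eq using assms(2) by simp
  ultimately have h: "n + CARD('p) + 1 \<le> 2 * h" "h \<le> n" "0 < h"
    by simp_all
  let ?E = "{real c / real n | c. 1 \<le> c \<and> c \<le> n \<and> bias t X c = \<infinity>}"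
  have "Min ?E = real (n - h + 1) / real n"
  proof (rule Min_eqI)
    show "finite ?E"
      by (rule finite_subset[of _ "(\<lambda>c. real c / real n) ` {..n}"]) auto
    show "real (n - h + 1) / real n \<in> ?E"
      using pcs_bias_infinite[of h X t] h assms(1,8) by force
    fix y assume "y \<in> ?E"
    then obtain c where c: "y = real c / real n" "bias t X c = \<infinity>"
      by blast
    \<comment> \<open>Up to \<open>n - h\<close> contaminated rows the bias is finite, so infinite
      bias needs at least one more.\<close>
    have "\<not> c \<le> n - h"
      using pcs_bias_bounded[OF assms(5), of h c t] c(2) h assms(1,8) by auto
    then show "real (n - h + 1) / real n \<le> y"
      unfolding c(1) by (intro divide_right_mono) auto
  qed
  then show ?thesis
    using h(2) by (simp add: breakdown_point_def assms(1) of_nat_diff)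
qed

end
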